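(* Let $\lambda\mathcal{B}_1$, $\lambda\mathcal{B}_2$, $\lambda\mathcal{B}_\infty\subset\mathbb{R}^n$ be the $\ell_1$-, $\ell_2$-, and $\ell_\infty$-balls centered at the origin and with radius $\lambda$. If $\lambda\geq 1$, then for any $\delta\in(0,1)$ we have $$2n\leq\#(\lambda\mathcal{B}_1\cap\mathbb{Z}^n)\leq n^{((2+\delta)\lfloor\lambda\rfloor)^2/2},$$ $$2n\leq\#(\lambda\mathcal{B}_2\cap\mathbb{Z}^n)\leq(1+2\lfloor\lambda\rfloor)^n,$$ $$(1+2\lfloor\lambda\rfloor)^n=\#(\lambda\mathcal{B}_\infty\cap\mathbb{Z}^n).$$ The upper bounds hold unconditionally, that is, for all $\lambda\geq 0$.
   Context: $\#V$ denotes the cardinality of a set $V$; $\lambda\mathcal{B}_p=\{x\in\mathbb{R}^n:\|x\|_p\leq\lambda\}$ for $p\in\{1,2,\infty\}$; $\lfloor r\rfloor$ is the floor of $r$.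
   Formalization: The upper bound for the ℓ1-ball fails for n=1, λ≥1 (1 < 3) and for n=2, 1≤λ<2 with δ < √(2 log₂ 5) − 2 (right side below 5); it is stated and proved with exactly these cases excluded. *)

theory Defs
  imports "HOL-Analysis.Analysis"
begin

definition l1_norm :: "real ^ 'n \<Rightarrow> real" where
  "l1_norm x = (\<Sum>i\<in>UNIV. \<bar>x $ i\<bar>)"

definition l1_ball :: "real \<Rightarrow> (real ^ 'n) set" where
  "l1_ball r = {x. l1_norm x \<le> r}"

text \<open>On \<^typ>\<open>real ^ 'n\<close>, \<^const>\<open>norm\<close> is the Euclidean norm and \<^const>\<open>infnorm\<close> is the
  maximum norm.\<close>

definition l2_ball :: "real \<Rightarrow> (real ^ 'n) set" where
  "l2_ball r = {x. norm x \<le> r}"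

definition linf_ball :: "real \<Rightarrow> (real ^ 'n) set" where
  "linf_ball r = {x. infnorm x \<le> r}"

definition int_points :: "(real ^ 'n) set" where
  "int_points = {x. \<forall>i. x $ i \<in> \<int>}"

end

theory Submission
  imports Defs
begin

text \<open>
  Everything reduces to integer radii, because \<open>l1_norm\<close> and \<^const>\<open>infnorm\<close> only take integer
  values on lattice points; write \<open>k\<close> for the floor of the radius \<open>r\<close>.

  The lattice points of the maximum-norm ball form the discrete cube of all maps from the
  index type to \<open>{-k..k}\<close>, which gives the exact count \<open>(1 + 2 * k) ^ n\<close>
  (\<open>card_linf_lattice\<close>).  The Euclidean ball lies inside this cube, hence its upper bound.  The
  cross-polytope lies inside the Euclidean ball, and for radius at least 1 it contains the
  \<open>2 * n\<close> signed unit vectors, hence both lower bounds.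

  For the upper bound on the cross-polytope, every nonzero lattice point moves one unit
  closer to the origin in \<open>l1_norm\<close> when a suitable signed unit vector is subtracted.  So every
  lattice point of norm at most \<open>k\<close> is a sum of \<open>k\<close> vectors, each a signed unit vector or zero,
  and there are at most \<open>(2 * n + 1) ^ k\<close> such sums (\<open>l1_lattice_finite_card\<close>).
  The exponent in the theorem is at least \<open>2 * k\<^sup>2\<close>, and \<open>2 * k \<le> 2 * k\<^sup>2\<close>.  For \<open>n \<ge> 3\<close> the
  inequality \<open>2 * n + 1 \<le> n\<^sup>2\<close> therefore suffices.  For \<open>n = 2\<close> and \<open>k \<ge> 2\<close> one uses
  \<open>5 \<le> 2 ^ 4\<close> and \<open>4 * k \<le> 2 * k\<^sup>2\<close> instead; for \<open>n = 2\<close> and \<open>k = 1\<close> there are exactly five points,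
  and the lower bound assumed on \<open>\<delta>\<close> is what makes the power of 2 reach 5
  (\<open>powr_dominates_l1_count\<close>).
\<close>

section \<open>Signed unit vectors\<close>

definition signed_units :: "(real ^ 'n) set" where
  "signed_units = (\<lambda>(i, s). axis i s) ` (UNIV \<times> {1, -1})"

lemma finite_signed_units: "finite (signed_units :: (real ^ 'n::finite) set)"
  unfolding signed_units_def by simp

lemma card_signed_units: "card (signed_units :: (real ^ 'n::finite) set) = 2 * CARD('n)"
proof -
  have "inj_on (\<lambda>(i, s). axis i s :: real ^ 'n) (UNIV \<times> {1, -1})"
    by (auto simp: inj_on_def axis_eq_axis)
  then show ?thesis
    unfolding signed_units_def by (simp add: card_image card_cartesian_product)
qed

lemma l1_norm_axis: "l1_norm (axis i s :: real ^ 'n::finite) = \<bar>s\<bar>"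
proof -
  have "l1_norm (axis i s :: real ^ 'n) = (\<Sum>j\<in>UNIV. if j = i then \<bar>s\<bar> else 0)"
    unfolding l1_norm_def by (rule sum.cong) (auto simp: axis_def)
  then show ?thesis by simp
qed

lemma signed_units_subset_l1_lattice:
  assumes "1 \<le> r"
  shows "(signed_units :: (real ^ 'n::finite) set) \<subseteq> l1_ball r \<inter> int_points"
  using assms by (auto simp: signed_units_def l1_ball_def int_points_def l1_norm_axis)
    (auto simp: axis_def)

section \<open>Lattice points of the cross-polytope\<close>

lemma l1_norm_eq_0_iff: "l1_norm x = 0 \<longleftrightarrow> x = (0 :: real ^ 'n::finite)"
  by (auto simp: l1_norm_def sum_nonneg_eq_0_iff vec_eq_iff)

lemma l1_norm_Ints:
  assumes "x \<in> int_points"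
  shows "l1_norm (x :: real ^ 'n::finite) \<in> \<int>"
  using assms by (auto simp: l1_norm_def int_points_def intro!: Ints_sum Ints_abs)

lemma le_floor_iff_Ints:
  fixes a r :: real
  assumes "a \<in> \<int>"
  shows "a \<le> of_int \<lfloor>r\<rfloor> \<longleftrightarrow> a \<le> r"
  using assms by (auto elim!: Ints_cases simp: le_floor_iff)

lemma l1_lattice_floor:
  "l1_ball r \<inter> int_points = (l1_ball (of_int \<lfloor>r\<rfloor>) \<inter> int_points :: (real ^ 'n::finite) set)"
  by (auto simp: l1_ball_def le_floor_iff_Ints[OF l1_norm_Ints])

text \<open>
  Subtracting the sign of a nonzero integer coordinate lowers the absolute value of this
  coordinate, and with it the norm, by exactly one.
\<close>

lemma l1_lattice_step:
  fixes x :: "real ^ 'n::finite"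
  assumes x: "x \<in> int_points" and "x \<noteq> 0"
  obtains e where "e \<in> signed_units" "x - e \<in> int_points" "l1_norm (x - e) = l1_norm x - 1"
proof -
  obtain i where i: "x $ i \<noteq> 0"
    using \<open>x \<noteq> 0\<close> by (auto simp: vec_eq_iff)
  obtain m where m: "x $ i = of_int m"
    using x by (auto simp: int_points_def elim: Ints_cases)
  let ?s = "sgn (x $ i)"
  let ?e = "axis i ?s :: real ^ 'n"
  have s: "?s \<in> {1, -1}" using i by (auto simp: sgn_if)
  have coord: "\<bar>x $ i - ?s\<bar> = \<bar>x $ i\<bar> - 1"
    using i unfolding m by (auto simp: sgn_if)
  have other: "(x - ?e) $ j = x $ j" if "j \<noteq> i" for j
    using that by (simp add: axis_def)
  have "l1_norm (x - ?e) = \<bar>x $ i - ?s\<bar> + (\<Sum>j\<in>UNIV - {i}. \<bar>(x - ?e) $ j\<bar>)"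
    unfolding l1_norm_def by (subst sum.remove[of _ i]) auto
  also have "\<dots> = \<bar>x $ i\<bar> - 1 + (\<Sum>j\<in>UNIV - {i}. \<bar>x $ j\<bar>)"
    unfolding coord using other by (simp add: axis_def)
  also have "\<dots> = l1_norm x - 1"
    unfolding l1_norm_def by (subst (2) sum.remove[of _ i]) auto
  finally have norm: "l1_norm (x - ?e) = l1_norm x - 1" .
  have "?s \<in> \<int>" using s by auto
  then have int: "x - ?e \<in> int_points"
    using x by (auto simp: int_points_def axis_def)
  show ?thesis
    using that[of ?e] s int norm by (force simp: signed_units_def)
qed

lemma l1_lattice_Suc_subset:
  "l1_ball (real (Suc k)) \<inter> int_points \<subseteq>
    (\<lambda>(y, e). y + e) ` ((l1_ball (real k) \<inter> int_points) \<times>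
      insert 0 (signed_units :: (real ^ 'n::finite) set))"
  (is "_ \<subseteq> ?add ` (?B \<times> ?E)")
proof
  fix x :: "real ^ 'n"
  assume x: "x \<in> l1_ball (real (Suc k)) \<inter> int_points"
  show "x \<in> ?add ` (?B \<times> ?E)"
  proof (cases "x = 0")
    case True
    then have "x \<in> ?B" using x by (simp add: l1_ball_def l1_norm_def)
    then show ?thesis by (intro image_eqI[of _ _ "(x, 0)"]) auto
  next
    case False
    then obtain e where "e \<in> signed_units" "x - e \<in> int_points"
      "l1_norm (x - e) = l1_norm x - 1"
      using l1_lattice_step x by (metis IntD2)
    then show ?thesis
      using x by (intro image_eqI[of _ _ "(x - e, e)"]) (auto simp: l1_ball_def)
  qed
qed

lemma l1_lattice_finite_card:
  "finite (l1_ball (real k) \<inter> int_points :: (real ^ 'n::finite) set) \<and>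
   card (l1_ball (real k) \<inter> int_points :: (real ^ 'n) set) \<le> (2 * CARD('n) + 1) ^ k"
proof (induction k)
  case 0
  have "0 \<le> l1_norm x" for x :: "real ^ 'n"
    by (simp add: l1_norm_def sum_nonneg)
  then have "l1_ball (real 0) \<inter> int_points = {0 :: real ^ 'n}"
    by (auto simp: l1_ball_def int_points_def order.antisym simp flip: l1_norm_eq_0_iff)
      (simp add: l1_norm_def)
  then show ?case by simp
next
  case (Suc k)
  let ?B = "l1_ball (real k) \<inter> int_points :: (real ^ 'n) set"
  let ?E = "insert 0 signed_units :: (real ^ 'n) set"
  let ?P = "(\<lambda>(y, e). y + e) ` (?B \<times> ?E)"
  have fin: "finite (?B \<times> ?E)" using Suc finite_signed_units by auto
  have "card ?P \<le> card ?B * card ?E"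
    using card_image_le[OF fin] by (metis card_cartesian_product)
  also have "\<dots> \<le> (2 * CARD('n) + 1) ^ k * (2 * CARD('n) + 1)"
  proof (rule mult_mono)
    show "card ?E \<le> 2 * CARD('n) + 1"
      by (simp add: card_insert_if finite_signed_units card_signed_units)
  qed (use Suc in auto)
  finally have "card ?P \<le> (2 * CARD('n) + 1) ^ Suc k" by (simp add: mult.commute)
  then show ?case
    using l1_lattice_Suc_subset[where 'n='n] fin
    by (meson card_mono finite_imageI finite_subset order_trans)
qed

section \<open>Lattice points of the cube\<close>

lemma infnorm_le_iff_cart:
  fixes x :: "real ^ 'n::finite"
  shows "infnorm x \<le> r \<longleftrightarrow> (\<forall>i. \<bar>x $ i\<bar> \<le> r)"
proof
  show "\<forall>i. \<bar>x $ i\<bar> \<le> r" if "infnorm x \<le> r"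
    using component_le_infnorm_cart[of x] that order_trans by blast
  show "infnorm x \<le> r" if "\<forall>i. \<bar>x $ i\<bar> \<le> r"
    unfolding infnorm_cart using that by (intro cSup_least) auto
qed

lemma linf_lattice_eq_image:
  "(linf_ball r \<inter> int_points :: (real ^ 'n::finite) set) =
    (\<lambda>f. \<chi> i. real_of_int (f i)) ` (UNIV \<rightarrow>\<^sub>E {-\<lfloor>r\<rfloor>..\<lfloor>r\<rfloor>})"
  (is "_ = ?v ` _")
proof (intro equalityI subsetI)
  fix x :: "real ^ 'n"
  assume x: "x \<in> linf_ball r \<inter> int_points"
  then have "\<forall>i. \<exists>m. x $ i = real_of_int m"
    by (auto simp: int_points_def elim: Ints_cases)
  then obtain f where f: "\<And>i. x $ i = real_of_int (f i)" by metis
  have "\<bar>real_of_int (f i)\<bar> \<le> r" for i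
    using x f by (simp add: linf_ball_def infnorm_le_iff_cart)
  then have "\<bar>f i\<bar> \<le> \<lfloor>r\<rfloor>" for i by (simp add: le_floor_iff)
  then have "f \<in> UNIV \<rightarrow>\<^sub>E {-\<lfloor>r\<rfloor>..\<lfloor>r\<rfloor>}" by (auto simp: abs_le_iff minus_le_iff)
  moreover have "x = ?v f" using f by (simp add: vec_eq_iff)
  ultimately show "x \<in> ?v ` (UNIV \<rightarrow>\<^sub>E {-\<lfloor>r\<rfloor>..\<lfloor>r\<rfloor>})" by blast
next
  fix x :: "real ^ 'n"
  assume "x \<in> ?v ` (UNIV \<rightarrow>\<^sub>E {-\<lfloor>r\<rfloor>..\<lfloor>r\<rfloor>})"
  then obtain f where f: "f \<in> UNIV \<rightarrow>\<^sub>E {-\<lfloor>r\<rfloor>..\<lfloor>r\<rfloor>}" and x: "x = ?v f" by blast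
  have "\<bar>f i\<bar> \<le> \<lfloor>r\<rfloor>" for i
  proof -
    have "f i \<in> {-\<lfloor>r\<rfloor>..\<lfloor>r\<rfloor>}" using f by blast
    then show ?thesis by auto
  qed
  then have "\<bar>real_of_int (f i)\<bar> \<le> r" for i by (simp add: le_floor_iff)
  then show "x \<in> linf_ball r \<inter> int_points"
    using x by (simp add: linf_ball_def infnorm_le_iff_cart int_points_def)
qed

lemma finite_linf_lattice: "finite (linf_ball r \<inter> int_points :: (real ^ 'n::finite) set)"
  unfolding linf_lattice_eq_image by (auto intro!: finite_imageI finite_PiE)

lemma card_linf_lattice:
  assumes "0 \<le> r"
  shows "int (card (linf_ball r \<inter> int_points :: (real ^ 'n::finite) set))
    = (1 + 2 * \<lfloor>r\<rfloor>) ^ CARD('n)"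
proof -
  have "inj_on (\<lambda>f. \<chi> i. real_of_int (f i) :: real ^ 'n) A" for A
    by (auto simp: inj_on_def vec_eq_iff)
  then have "card (linf_ball r \<inter> int_points :: (real ^ 'n) set)
      = card ((UNIV :: 'n set) \<rightarrow>\<^sub>E {-\<lfloor>r\<rfloor>..\<lfloor>r\<rfloor>})"
    unfolding linf_lattice_eq_image by (simp add: card_image)
  also have "\<dots> = nat (1 + 2 * \<lfloor>r\<rfloor>) ^ CARD('n)"
    by (simp add: card_PiE algebra_simps)
  finally show ?thesis using assms by simp
qed

lemma l1_ball_subset_l2_ball: "l1_ball r \<subseteq> (l2_ball r :: (real ^ 'n::finite) set)"
  unfolding l1_ball_def l2_ball_def l1_norm_def
  using norm_le_l1_cart order_trans by blast

lemma l2_ball_subset_linf_ball: "l2_ball r \<subseteq> (linf_ball r :: (real ^ 'n::finite) set)"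
  unfolding l2_ball_def linf_ball_def using infnorm_le_norm order_trans by blast

section \<open>Comparing the two bounds for the cross-polytope\<close>

text \<open>
  The exceptions are forced: for \<open>n = 1\<close> the right-hand side is always 1, and for \<open>n = 2\<close>,
  \<open>k = 1\<close> it tends to 4 as \<open>\<delta>\<close> tends to 0, while the left-hand side is 5.  Indeed
  \<open>sqrt (2 * log 2 5) - 2\<close> is the value of \<open>\<delta>\<close> at which the right-hand side equals 5.
\<close>

lemma powr_dominates_l1_count:
  fixes \<delta> :: real
  assumes "0 < n" "0 < \<delta>" "n = 1 \<Longrightarrow> k = 0"
    and two: "n = 2 \<Longrightarrow> k = 1 \<Longrightarrow> sqrt (2 * log 2 5) - 2 \<le> \<delta>"
  shows "real ((2 * n + 1) ^ k) \<le> real n powr (((2 + \<delta>) * real k)\<^sup>2 / 2)"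
proof -
  have "(2::real)\<^sup>2 \<le> (2 + \<delta>)\<^sup>2" using \<open>0 < \<delta>\<close> by (intro power_mono) auto
  then have exponent_ge: "2 * (real k)\<^sup>2 \<le> ((2 + \<delta>) * real k)\<^sup>2 / 2"
    by (simp add: power_mult_distrib mult_right_mono)
  consider "k = 0" | "n = 2" "k = 1" | "n = 2" "2 \<le> k" | "3 \<le> n" "1 \<le> k"
    using assms by linarith
  then show ?thesis
  proof cases
    case 1
    then show ?thesis using \<open>0 < n\<close> by simp
  next
    case 2
    have log: "0 \<le> 2 * log 2 5" by simp
    have "sqrt (2 * log 2 5) \<le> 2 + \<delta>" using two 2 by simp
    then have "(sqrt (2 * log 2 5))\<^sup>2 \<le> (2 + \<delta>)\<^sup>2" by (rule power_mono) (use log in simp)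
    then have "log 2 5 \<le> (2 + \<delta>)\<^sup>2 / 2" using log by simp
    then have "2 powr log 2 5 \<le> 2 powr ((2 + \<delta>)\<^sup>2 / 2)" by (rule powr_mono) simp
    then show ?thesis using 2 by simp
  next
    case 3
    have "4 * real k \<le> 2 * (real k)\<^sup>2"
      using 3 by (simp add: power2_eq_square)
    then have exponent: "real (4 * k) \<le> ((2 + \<delta>) * real k)\<^sup>2 / 2"
      using exponent_ge by linarith
    have "real ((2 * n + 1) ^ k) = 5 ^ k" using 3 by simp
    also have "\<dots> \<le> (2 ^ 4) ^ k" by (rule power_mono) auto
    also have "\<dots> = 2 powr real (4 * k)" by (simp only: power_mult powr_realpow zero_less_numeral)
    also have "\<dots> \<le> 2 powr (((2 + \<delta>) * real k)\<^sup>2 / 2)"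
      using exponent by (rule powr_mono) simp
    finally show ?thesis using 3 by simp
  next
    case 4
    have "2 * real k \<le> 2 * (real k)\<^sup>2"
      using 4 by (simp add: power2_eq_square)
    then have exponent: "real (2 * k) \<le> ((2 + \<delta>) * real k)\<^sup>2 / 2"
      using exponent_ge by linarith
    have "2 * n + 1 \<le> 3 * n" using 4 by simp
    also have "\<dots> \<le> n\<^sup>2" using 4 by (simp add: power2_eq_square)
    finally have "(2 * n + 1) ^ k \<le> (n\<^sup>2) ^ k" by (rule power_mono) simp
    then have "real ((2 * n + 1) ^ k) \<le> real (n ^ (2 * k))"
      unfolding power_mult of_nat_le_iff .
    also have "\<dots> = real n powr real (2 * k)"
      using \<open>0 < n\<close> by (simp only: of_nat_power powr_realpow of_nat_0_less_iff)
    also have "\<dots> \<le> real n powr (((2 + \<delta>) * real k)\<^sup>2 / 2)"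
      using exponent by (rule powr_mono) (use 4 in simp)
    finally show ?thesis .
  qed
qed

section \<open>The three counts\<close>

theorem corollary1:
  fixes r \<delta> :: real
  assumes "0 \<le> r" and "0 < \<delta>" and "\<delta> < 1"
  shows
    "let n = CARD('n::finite);
         Z1 = l1_ball r \<inter> (int_points :: (real ^ 'n) set);
         Z2 = l2_ball r \<inter> (int_points :: (real ^ 'n) set);
         Zinf = linf_ball r \<inter> (int_points :: (real ^ 'n) set)
     in finite Z1 \<and> finite Z2 \<and> finite Zinf \<and>
        (1 \<le> r \<longrightarrow>
           2 * n \<le> card Z1 \<and>
           2 * n \<le> card Z2 \<and>
           (1 + 2 * \<lfloor>r\<rfloor>) ^ n = int (card Zinf)) \<and>
        ((n = 1 \<longrightarrow> r < 1) \<and>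
         (n = 2 \<longrightarrow> r < 1 \<or> 2 \<le> r \<or> sqrt (2 * log 2 5) - 2 \<le> \<delta>) \<longrightarrow>
           real (card Z1) \<le> real n powr (((2 + \<delta>) * real_of_int \<lfloor>r\<rfloor>)\<^sup>2 / 2)) \<and>
        int (card Z2) \<le> (1 + 2 * \<lfloor>r\<rfloor>) ^ n \<and>
        int (card Zinf) \<le> (1 + 2 * \<lfloor>r\<rfloor>) ^ n"
proof -
  let ?Z1 = "l1_ball r \<inter> int_points :: (real ^ 'n) set"
  let ?Z2 = "l2_ball r \<inter> int_points :: (real ^ 'n) set"
  let ?Zinf = "linf_ball r \<inter> int_points :: (real ^ 'n) set"
  define k where "k = nat \<lfloor>r\<rfloor>"
  have k: "real k = of_int \<lfloor>r\<rfloor>" using \<open>0 \<le> r\<close> by (simp add: k_def)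
  have Z1: "?Z1 = l1_ball (real k) \<inter> int_points"
    unfolding k by (rule l1_lattice_floor)
  have Z12: "?Z1 \<subseteq> ?Z2" using l1_ball_subset_l2_ball by blast
  have Z2inf: "?Z2 \<subseteq> ?Zinf" using l2_ball_subset_linf_ball by blast
  have fin: "finite ?Zinf" by (rule finite_linf_lattice)
  have fin2: "finite ?Z2" using Z2inf fin by (rule finite_subset)
  have fin1: "finite ?Z1" using Z12 fin2 by (rule finite_subset)
  have card_inf: "int (card ?Zinf) = (1 + 2 * \<lfloor>r\<rfloor>) ^ CARD('n)"
    using \<open>0 \<le> r\<close> by (rule card_linf_lattice)
  have card2: "int (card ?Z2) \<le> (1 + 2 * \<lfloor>r\<rfloor>) ^ CARD('n)"
    using card_mono[OF fin Z2inf] card_inf by linarith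
  have lower1: "2 * CARD('n) \<le> card ?Z1" if "1 \<le> r"
    using card_mono[OF fin1 signed_units_subset_l1_lattice[OF that]]
    by (simp add: card_signed_units)
  have lower2: "2 * CARD('n) \<le> card ?Z2" if "1 \<le> r"
    using lower1[OF that] card_mono[OF fin2 Z12] by linarith
  have upper1: "real (card ?Z1) \<le> real CARD('n) powr (((2 + \<delta>) * real_of_int \<lfloor>r\<rfloor>)\<^sup>2 / 2)"
    if one: "CARD('n) = 1 \<longrightarrow> r < 1"
      and two: "CARD('n) = 2 \<longrightarrow> r < 1 \<or> 2 \<le> r \<or> sqrt (2 * log 2 5) - 2 \<le> \<delta>"
  proof -
    have "card ?Z1 \<le> (2 * CARD('n) + 1) ^ k"
      unfolding Z1 using l1_lattice_finite_card by blast
    then have "real (card ?Z1) \<le> real ((2 * CARD('n) + 1) ^ k)"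
      by (rule of_nat_mono)
    also have "\<dots> \<le> real CARD('n) powr (((2 + \<delta>) * real k)\<^sup>2 / 2)"
    proof (rule powr_dominates_l1_count)
      show "k = 0" if "CARD('n) = 1"
        using one that by (simp add: k_def)
      show "sqrt (2 * log 2 5) - 2 \<le> \<delta>" if "CARD('n) = 2" "k = 1"
      proof -
        have "1 \<le> r" "r < 2" using k \<open>k = 1\<close> by linarith+
        then show ?thesis using two \<open>CARD('n) = 2\<close> by auto
      qed
    qed (use \<open>0 < \<delta>\<close> in auto)
    finally show ?thesis unfolding k .
  qed
  show ?thesis
    unfolding Let_def
    using fin1 fin2 fin lower1 lower2 card_inf card2 upper1 by auto
qed

end
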